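(* Let $M$ be a torsion-free reduced monoid satisfying the ACCP, and let $S$ be a semidomain such that the set of nonzero coefficients of each indecomposable polynomial expression in $S[M]$ has a maximal common divisor in $S$. Then the following statements hold. (1) If $S$ is almost atomic, then $S[M]$ is almost atomic. (2) If $S$ is quasi-atomic, then $S[M]$ is quasi-atomic.
   Context: Monoids are cancellative and commutative, with identity. A monoid is reduced if its only invertible element is the identity, and torsion-free if its Grothendieck group is torsion-free. In a multiplicatively written monoid $H$: an atom is a non-invertible element $a$ such that $a=bc$ with $b,c\in H$ implies that $b$ or $c$ is invertible; an element is atomic if it is invertible or a product of finitely many atoms; $H$ is almost atomic (resp., quasi-atomic) if for each $b\in H$ there is an atomic element $a\in H$ (resp., an element $a\in H$) such that $ab$ is atomic. A monoid satisfies the ACCP if every ascending chain of its principal ideals stabilizes (for an additively written monoid, principal ideals are the sets $b+M$). A common divisor of a nonempty subset $T\subseteq H$ is an element $d\in H$ dividing every $t\in T$; it is a maximal common divisor (MCD) of $T$ if the only common divisors of $\{t/d : t\in T\}$ are the units of $H$. A semiring is a set $S$ with addition and multiplication such that $(S,+)$ is a (cancellative, commutative) monoid with identity $0$, multiplication is commutative and associative with identity $1$, and multiplication distributes over addition. A semidomain is a semiring whose multiplication extends to the Grothendieck group of $(S,+)$ making it an integral domain (equivalently, a semiring isomorphic to a subsemiring, containing $1$, of an integral domain). $S^*$ denotes the multiplicative monoid of nonzero elements of $S$, and $S$ is almost atomic (resp., quasi-atomic) if $S^*$ is; an MCD in $S$ means an MCD in $S^*$. For a semidomain $S$ and an additively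 written torsion-free monoid $M$, $S[M]$ is the monoid semidomain of all polynomial expressions $\sum_i c_i x^{q_i}$ (finite sums) with coefficients $c_i\in S$ and exponents $q_i\in M$, with polynomial-like operations; it is a semidomain. Elements of $S$ are the constant polynomial expressions. A nonzero polynomial expression in $S[M]$ is indecomposable if it is not the product of two nonconstant polynomial expressions in $S[M]$. *)

theory Defs
  imports "HOL-Library.Poly_Mapping" "HOL-Library.Multiset"
    "HOL-Computational_Algebra.Factorial_Ring"
begin

section \<open>The Grothendieck group of a cancellative commutative monoid\<close>

text \<open>
  An additively written cancellative commutative monoid is a type of sort
  \<open>{comm_monoid_add, cancel_semigroup_add}\<close>. The class \<open>cancel_comm_monoid_add\<close> is not used,
  since it demands a (truncated) subtraction subject to axioms of its own; for the same reason
  semirings with cancellative addition have sort \<open>{comm_semiring_1, cancel_semigroup_add}\<close> rather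
  than \<open>comm_semiring_1_cancel\<close>. The pair \<open>(a, b)\<close> stands for the formal difference \<open>a - b\<close>.
\<close>

definition grothrel ::
  "'a::{comm_monoid_add, cancel_semigroup_add} \<times> 'a \<Rightarrow> 'a \<times> 'a \<Rightarrow> bool"
  where "grothrel = (\<lambda>(x, y) (u, v). x + v = u + y)"

lemma grothrel_iff [simp]: "grothrel (x, y) (u, v) \<longleftrightarrow> x + v = u + y"
  by (simp add: grothrel_def)

quotient_type (overloaded) 'a groth =
  "'a::{comm_monoid_add, cancel_semigroup_add} \<times> 'a" / grothrel
proof (rule equivpI)
  show "reflp (grothrel :: 'a \<times> 'a \<Rightarrow> _)" by (auto simp: reflp_def)
  show "symp (grothrel :: 'a \<times> 'a \<Rightarrow> _)" by (auto simp: symp_def)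
  show "transp (grothrel :: 'a \<times> 'a \<Rightarrow> _)"
  proof (rule transpI, clarsimp)
    fix a b c d e f :: 'a
    assume 1: "a + d = c + b" and 2: "c + f = e + d"
    have "d + (a + f) = (a + d) + f" by (simp add: ac_simps)
    also have "\<dots> = b + (c + f)" by (simp add: 1 ac_simps)
    also have "\<dots> = d + (e + b)" by (simp add: 2 ac_simps)
    finally show "a + f = e + b" by (rule add_left_imp_eq)
  qed
qed

lemma groth_add_aux:
  fixes a b c d a' b' c' d' :: "'a::comm_monoid_add"
  assumes 1: "a + b = c + d" and 2: "a' + b' = c' + d'"
  shows "(a + a') + (b + b') = (c + c') + (d + d')"
proof -
  have "(a + a') + (b + b') = (a + b) + (a' + b')" by (simp only: ac_simps)
  also have "\<dots> = (c + d) + (c' + d')" by (simp only: 1 2)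
  also have "\<dots> = (c + c') + (d + d')" by (simp only: ac_simps)
  finally show ?thesis .
qed

instantiation groth :: ("{comm_monoid_add, cancel_semigroup_add}") ab_group_add
begin

lift_definition zero_groth :: "'a groth" is "(0, 0)" .

lift_definition plus_groth :: "'a groth \<Rightarrow> 'a groth \<Rightarrow> 'a groth"
  is "\<lambda>(x, y) (u, v). (x + u, y + v)"
  by (clarsimp simp only: grothrel_iff case_prod_conv split_paired_all) (rule groth_add_aux)

lift_definition uminus_groth :: "'a groth \<Rightarrow> 'a groth"
  is "\<lambda>(x, y). (y, x)"
  by (clarsimp simp: add.commute)

lift_definition minus_groth :: "'a groth \<Rightarrow> 'a groth \<Rightarrow> 'a groth"
  is "\<lambda>(x, y) (u, v). (x + v, y + u)"
  by (clarsimp simp only: grothrel_iff case_prod_conv split_paired_all)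
     (rule groth_add_aux, assumption, simp only: add.commute)

instance
  by standard (transfer; clarsimp simp: ac_simps)+

end

lift_definition of_groth :: "'a::{comm_monoid_add, cancel_semigroup_add} \<Rightarrow> 'a groth"
  is "\<lambda>a. (a, 0)" .

lemma of_groth_0: "of_groth 0 = 0"
  by transfer simp

lemma of_groth_add: "of_groth (a + b) = of_groth a + of_groth b"
  by transfer simp

lemma inj_of_groth: "inj of_groth"
  by (rule injI, transfer) simp

lemma groth_diff_cases: obtains a b where "z = of_groth a - of_groth b"
proof -
  have "\<exists>a b. z = of_groth a - of_groth b"
    by transfer (auto simp: ac_simps)
  thus ?thesis using that by blast
qed

text \<open>The multiplication below is the only distributive extension of the given one.\<close>

instantiation groth :: ("{comm_semiring_1, cancel_semigroup_add}") comm_ring_1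
begin

lift_definition one_groth :: "'a groth" is "(1, 0)" .

lift_definition times_groth :: "'a groth \<Rightarrow> 'a groth \<Rightarrow> 'a groth"
  is "\<lambda>(x, y) (u, v). (x * u + y * v, x * v + y * u)"
proof (unfold grothrel_def, clarify)
  fix s t u v w x y z :: 'a
  assume 1: "s + v = u + t" and 2: "w + z = y + x"
  have "(s * w + t * x) + (u * z + v * y) + (v * w + u * w)
      = (s + v) * w + t * x + u * (w + z) + v * y"
    by (simp add: algebra_simps)
  also have "\<dots> = (u + t) * w + t * x + u * (y + x) + v * y"
    by (simp only: 1 2)
  also have "\<dots> = u * w + t * w + (u + t) * x + u * y + v * y"
    by (simp add: algebra_simps)
  also have "\<dots> = u * w + t * w + (s + v) * x + u * y + v * y"
    by (simp only: 1)
  also have "\<dots> = u * w + t * w + s * x + u * y + v * (y + x)"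
    by (simp add: algebra_simps)
  also have "\<dots> = u * w + t * w + s * x + u * y + v * (w + z)"
    by (simp only: 2)
  also have "\<dots> = (u * y + v * z) + (s * x + t * w) + (v * w + u * w)"
    by (simp add: algebra_simps)
  finally show "(s * w + t * x) + (u * z + v * y) = (u * y + v * z) + (s * x + t * w)"
    by (rule add_right_imp_eq)
qed

instance
proof
  show "(0 :: 'a groth) \<noteq> 1" by transfer simp
qed (transfer; clarsimp simp: algebra_simps)+

end

lemma of_groth_1: "of_groth 1 = 1"
  by transfer simp

lemma of_groth_mult: "of_groth (a * b) = of_groth a * of_groth b"
  by transfer simp

section \<open>Conditions on the exponent monoid\<close>

definition torsion_free_monoid :: "'m::{comm_monoid_add, cancel_semigroup_add} itself \<Rightarrow> bool"
  where "torsion_free_monoid _ \<longleftrightarrow>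
    (\<forall>(x :: 'm groth) (n :: nat). n > 0 \<and> (\<Sum>i<n. x) = 0 \<longrightarrow> x = 0)"

definition reduced_monoid :: "'m::comm_monoid_add itself \<Rightarrow> bool"
  where "reduced_monoid _ \<longleftrightarrow> (\<forall>a :: 'm. (\<exists>b. a + b = 0) \<longrightarrow> a = 0)"

definition principal_ideal :: "'m::comm_monoid_add \<Rightarrow> 'm set"
  where "principal_ideal b = {b + m | m. True}"

definition satisfies_ACCP :: "'m::comm_monoid_add itself \<Rightarrow> bool"
  where "satisfies_ACCP _ \<longleftrightarrow>
    (\<forall>b :: nat \<Rightarrow> 'm. (\<forall>n. principal_ideal (b n) \<subseteq> principal_ideal (b (Suc n))) \<longrightarrow>
       (\<exists>N. \<forall>n\<ge>N. principal_ideal (b n) = principal_ideal (b N)))"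

section \<open>Semidomains and their multiplicative monoids\<close>

definition semidomain :: "'s::{comm_semiring_1, cancel_semigroup_add} itself \<Rightarrow> bool"
  where "semidomain _ \<longleftrightarrow> (\<forall>(x :: 's groth) y. x * y = 0 \<longrightarrow> x = 0 \<or> y = 0)"

text \<open>
  The following notions refer to the monoid \<open>S\<^sup>*\<close> of nonzero elements of a semidomain \<open>S\<close>.
  Divisibility and invertibility in \<open>S\<^sup>*\<close> are those of \<open>S\<close>, restricted to nonzero elements,
  and the atoms of \<open>S\<^sup>*\<close> are the elements satisfying \<^const>\<open>irreducible\<close>.
\<close>

definition atomic_elem :: "'s::comm_semiring_1 \<Rightarrow> bool"
  where "atomic_elem a \<longleftrightarrow>
    a dvd 1 \<or> (\<exists>A. A \<noteq> {#} \<and> (\<forall>p \<in># A. irreducible p) \<and> a = prod_mset A)"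

definition almost_atomic :: "'s::comm_semiring_1 itself \<Rightarrow> bool"
  where "almost_atomic _ \<longleftrightarrow>
    (\<forall>b :: 's. b \<noteq> 0 \<longrightarrow> (\<exists>a. a \<noteq> 0 \<and> atomic_elem a \<and> atomic_elem (a * b)))"

definition quasi_atomic :: "'s::comm_semiring_1 itself \<Rightarrow> bool"
  where "quasi_atomic _ \<longleftrightarrow>
    (\<forall>b :: 's. b \<noteq> 0 \<longrightarrow> (\<exists>a. a \<noteq> 0 \<and> atomic_elem (a * b)))"

definition common_divisor :: "'s::comm_semiring_1 \<Rightarrow> 's set \<Rightarrow> bool"
  where "common_divisor d T \<longleftrightarrow> d \<noteq> 0 \<and> (\<forall>t\<in>T. d dvd t)"

text \<open>
  For a nonempty set \<open>T\<close> of nonzero elements with common divisor \<open>d\<close>, the set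
  \<open>{u. d * u \<in> T}\<close> is \<open>{t / d : t \<in> T}\<close>.
\<close>

definition maximal_common_divisor :: "'s::comm_semiring_1 \<Rightarrow> 's set \<Rightarrow> bool"
  where "maximal_common_divisor d T \<longleftrightarrow>
    common_divisor d T \<and> (\<forall>e. common_divisor e {u. d * u \<in> T} \<longrightarrow> e dvd 1)"

section \<open>Monoid semidomains\<close>

text \<open>
  The monoid semidomain \<open>S[M]\<close> is the type \<open>'m \<Rightarrow>\<^sub>0 's\<close> of finitely supported functions with
  convolution as multiplication; \<open>Poly_Mapping.single q c\<close> is the monomial \<open>c x\<^sup>q\<close>, and
  \<^const>\<open>Poly_Mapping.range\<close> is the set of nonzero coefficients.
\<close>

definition constant_poly :: "('m::comm_monoid_add \<Rightarrow>\<^sub>0 's::comm_semiring_1) \<Rightarrow> bool"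
  where "constant_poly f \<longleftrightarrow> (\<exists>c. f = Poly_Mapping.single 0 c)"

definition indecomposable :: "('m::comm_monoid_add \<Rightarrow>\<^sub>0 's::comm_semiring_1) \<Rightarrow> bool"
  where "indecomposable f \<longleftrightarrow> f \<noteq> 0 \<and>
    \<not> (\<exists>g h. \<not> constant_poly g \<and> \<not> constant_poly h \<and> f = g * h)"

end

theory Submission
  imports Defs
begin

text \<open>
  A torsion-free \<open>M\<close> carries a translation-invariant total order, so the largest and the smallest
  exponent of a product in \<open>S[M]\<close> are the sums of those of the factors. Since \<open>M\<close> is reduced with
  ACCP, proper divisibility in \<open>M\<close> is well-founded, and well-founded induction on the pair of extreme
  exponents splits every nonzero \<open>f\<close> into indecomposable factors. Dividing such a factor by an MCD
  of its coefficients leaves a unit or an atom, because a constant dividing the quotient must be a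
  unit. Hence \<open>f = d g\<close> with \<open>d \<in> S\<close> and \<open>g\<close> atomic, and a multiplier making \<open>d\<close> atomic in \<open>S\<close> also
  makes \<open>f\<close> atomic in \<open>S[M]\<close>.
\<close>

section \<open>Orders on torsion-free groups\<close>

text \<open>A locale rather than a type class, since the order is constructed inside the proof and
  is used together with its converse.\<close>

locale additive_order =
  fixes le :: "'m::{comm_monoid_add, cancel_semigroup_add} \<Rightarrow> 'm \<Rightarrow> bool"
  assumes total: "le a b \<or> le b a"
    and antisym: "le a b \<Longrightarrow> le b a \<Longrightarrow> a = b"
    and trans: "le a b \<Longrightarrow> le b c \<Longrightarrow> le a c"
    and add_right: "le a b \<Longrightarrow> le (a + c) (b + c)"

text \<open>Carries facts about largest exponents over to smallest ones.\<close>

lemma additive_order_converse: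
  assumes "additive_order le"
  shows "additive_order (\<lambda>a b. le b a)"
proof -
  interpret additive_order le by fact
  show ?thesis
  proof
    fix a b c
    show "le b a \<or> le a b" by (rule total)
    show "a = b" if "le b a" "le a b" using that(2,1) by (rule antisym)
    show "le c a" if "le b a" "le c b" using that(2,1) by (rule trans)
    show "le (b + c) (a + c)" if "le b a" using that by (rule add_right)
  qed
qed

text \<open>The nonnegative elements of a translation-invariant partial order, in which a \<le> b
  means that b - a lies in \<open>P\<close>.\<close>

definition positive_cone :: "'g::ab_group_add set \<Rightarrow> bool"
  where "positive_cone P \<longleftrightarrow>
    0 \<in> P \<and> (\<forall>a\<in>P. \<forall>b\<in>P. a + b \<in> P) \<and> (\<forall>a\<in>P. - a \<in> P \<longrightarrow> a = 0)"

section \<open>Extending positive cones to total ones\<close>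

lemma positive_cone_multiple:
  assumes "positive_cone P" "x \<in> P"
  shows "(\<Sum>i<(n::nat). x) \<in> P"
  using assms by (induction n) (auto simp: positive_cone_def)

lemma sum_const_add:
  fixes x :: "'g::ab_group_add"
  shows "(\<Sum>i<m + n. x) = (\<Sum>i<(m::nat). x) + (\<Sum>i<(n::nat). x)"
  by (induction n) (auto simp: add.assoc)

lemma sum_const_mult:
  fixes x :: "'g::ab_group_add"
  shows "(\<Sum>i<(m::nat). \<Sum>j<(n::nat). x) = (\<Sum>i<m * n. x)"
  by (induction m) (simp_all add: sum_const_add add.commute)

text \<open>Zorn's lemma, starting from the cone {0}. The union of a nonempty chain of cones is a
  cone because any two of its elements already lie in one member.\<close>

lemma exists_maximal_positive_cone:
  obtains P :: "'g::ab_group_add set" where "positive_cone P"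
    and "\<And>Q. positive_cone Q \<Longrightarrow> P \<subseteq> Q \<Longrightarrow> Q = P"
proof -
  let ?A = "{P :: 'g set. positive_cone P}"
  have "{0} \<in> ?A" by (simp add: positive_cone_def)
  moreover have "\<Union>C \<in> ?A" if ne: "C \<noteq> {}" and ch: "subset.chain ?A C" for C
  proof -
    have pc: "positive_cone X" if "X \<in> C" for X
      using ch that by (auto simp: subset.chain_def)
    have common: "\<exists>X\<in>C. a \<in> X \<and> b \<in> X" if ab: "a \<in> \<Union>C" "b \<in> \<Union>C" for a b
    proof -
      obtain X Y where XY: "X \<in> C" "a \<in> X" "Y \<in> C" "b \<in> Y"
        using ab by blast
      have "X \<subseteq> Y \<or> Y \<subseteq> X"
        using ch XY by (auto simp: subset_chain_def)
      thus ?thesis using XY by blast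
    qed
    have "0 \<in> \<Union>C" using ne pc by (auto simp: positive_cone_def)
    moreover have "a + b \<in> \<Union>C" if "a \<in> \<Union>C" "b \<in> \<Union>C" for a b
      using common[OF that] pc by (auto simp: positive_cone_def)
    moreover have "a = 0" if "a \<in> \<Union>C" "- a \<in> \<Union>C" for a
      using common[OF that] pc by (auto simp: positive_cone_def)
    ultimately show ?thesis unfolding mem_Collect_eq positive_cone_def by blast
  qed
  ultimately obtain P where "P \<in> ?A" "\<forall>Q\<in>?A. P \<subseteq> Q \<longrightarrow> Q = P"
    using subset_Zorn_nonempty[of ?A] by blast
  thus ?thesis using that by blast
qed

text \<open>Adjoining x yields the additively closed set \<open>Q\<close> = P + Nx, which by
  maximality is not a cone and so contains some y \<noteq> 0 together with -y. Adding y = p + mx and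
  -y = q + nx gives -(m + n)x = p + q, an element of P.\<close>

lemma maximal_positive_cone_notin:
  assumes P: "positive_cone P" and max: "\<And>Q. positive_cone Q \<Longrightarrow> P \<subseteq> Q \<Longrightarrow> Q = P"
    and x: "x \<notin> P"
  obtains k :: nat where "k > 0" "- (\<Sum>i<k. x) \<in> P"
proof -
  define Q where "Q = {p + (\<Sum>i<(n::nat). x) | p n. p \<in> P}"
  have P0: "0 \<in> P" and Padd: "\<And>a b. a \<in> P \<Longrightarrow> b \<in> P \<Longrightarrow> a + b \<in> P"
    and Pneg: "\<And>a. a \<in> P \<Longrightarrow> - a \<in> P \<Longrightarrow> a = 0"
    using P unfolding positive_cone_def by blast+
  have QI: "p + (\<Sum>i<n. x) \<in> Q" if "p \<in> P" for p and n :: nat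
    using that by (auto simp: Q_def)
  have PQ: "P \<subseteq> Q"
  proof
    fix p assume "p \<in> P"
    from QI[OF this, of 0] show "p \<in> Q" by simp
  qed
  have "x \<in> Q" using QI[OF P0, of 1] by simp
  hence "\<not> positive_cone Q" using max[OF _ PQ] x by blast
  moreover have "0 \<in> Q" using P0 PQ by blast
  moreover have "a + b \<in> Q" if ab: "a \<in> Q" "b \<in> Q" for a b
  proof -
    obtain p m q n where "a = p + (\<Sum>i<(m::nat). x)" "p \<in> P" "b = q + (\<Sum>i<(n::nat). x)" "q \<in> P"
      using ab unfolding Q_def by blast
    hence "a + b = (p + q) + (\<Sum>i<m + n. x)"
      by (simp only: sum_const_add ac_simps)
    thus ?thesis using QI Padd \<open>p \<in> P\<close> \<open>q \<in> P\<close> by simp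
  qed
  ultimately obtain y where y: "y \<in> Q" "- y \<in> Q" "y \<noteq> 0"
    unfolding positive_cone_def by blast
  obtain p m where p: "p \<in> P" "y = p + (\<Sum>i<(m::nat). x)"
    using y(1) unfolding Q_def by blast
  obtain q n where q: "q \<in> P" "- y = q + (\<Sum>i<(n::nat). x)"
    using y(2) unfolding Q_def by blast
  have "(\<Sum>i<m + n. x) + (p + q) = (p + (\<Sum>i<m. x)) + (q + (\<Sum>i<n. x))"
    by (simp only: sum_const_add ac_simps)
  also have "\<dots> = y + - y"
    by (simp only: p(2)[symmetric] q(2)[symmetric])
  finally have "- (\<Sum>i<m + n. x) = p + q"
    by (intro minus_unique) simp
  hence neg: "- (\<Sum>i<m + n. x) \<in> P" using Padd[OF p(1) q(1)] by argo
  \<comment> \<open>If m = n = 0, then y and -y both lie in P itself, which forces y = 0.\<close>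
  have "m + n > 0"
  proof (rule ccontr)
    assume "\<not> m + n > 0"
    hence "m = 0" "n = 0" by simp_all
    hence "y = p" "- y = q" using p(2) q(2) by simp_all
    thus False using Pneg[OF p(1)] q(1) y(3) by simp
  qed
  thus ?thesis using neg by (rule that)
qed

text \<open>If a maximal cone misses both x and -x, it contains -kx and lx for some k, l > 0, hence
  both klx and -klx. So klx = 0, and torsion-freeness gives x = 0, which is in the cone.\<close>

lemma torsion_free_exists_total_cone:
  assumes tf: "\<And>(x::'g::ab_group_add) n. (n::nat) > 0 \<Longrightarrow> (\<Sum>i<n. x) = 0 \<Longrightarrow> x = 0"
  obtains P :: "'g::ab_group_add set" where "positive_cone P" "\<And>x. x \<in> P \<or> - x \<in> P"
proof -
  obtain P :: "'g set" where P: "positive_cone P"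
    and max: "\<And>Q. positive_cone Q \<Longrightarrow> P \<subseteq> Q \<Longrightarrow> Q = P"
    using exists_maximal_positive_cone by blast
  have neg: "\<exists>k::nat. k > 0 \<and> - (\<Sum>i<k. x) \<in> P" if x: "x \<notin> P" for x
    by (rule maximal_positive_cone_notin[OF P max x]) auto
  have "x \<in> P \<or> - x \<in> P" for x
  proof (rule ccontr)
    assume x: "\<not> (x \<in> P \<or> - x \<in> P)"
    obtain k :: nat where k: "k > 0" "- (\<Sum>i<k. x) \<in> P"
      using neg x by blast
    obtain l :: nat where l: "l > 0" "- (\<Sum>i<l. - x) \<in> P"
      using neg x by blast
    have "(\<Sum>i<k. \<Sum>j<l. x) \<in> P"
      using positive_cone_multiple[OF P l(2)] by (simp add: sum_negf)
    moreover have "- (\<Sum>i<l. \<Sum>j<k. x) \<in> P"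
      using positive_cone_multiple[OF P k(2), of l] by (simp add: sum_negf)
    ultimately have "(\<Sum>i<k * l. x) = 0"
      using P by (simp add: positive_cone_def sum_const_mult mult.commute)
    hence "x = 0" using tf[of "k * l"] k l by simp
    thus False using x P by (simp add: positive_cone_def)
  qed
  thus ?thesis using that P by blast
qed

text \<open>A total cone orders the Grothendieck group, and this order is pulled back along
  \<open>of_groth\<close>, whose injectivity yields antisymmetry.\<close>

lemma torsion_free_imp_additive_order:
  assumes "torsion_free_monoid TYPE('m::{comm_monoid_add, cancel_semigroup_add})"
  obtains le :: "'m::{comm_monoid_add, cancel_semigroup_add} \<Rightarrow> 'm \<Rightarrow> bool" where "additive_order le"
proof -
  obtain P :: "'m groth set" where P: "positive_cone P" and tot: "\<And>x. x \<in> P \<or> - x \<in> P"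
  proof (rule torsion_free_exists_total_cone)
    show "x = 0" if "n > 0" "(\<Sum>i<n. x) = 0" for x :: "'m groth" and n :: nat
      using assms that unfolding torsion_free_monoid_def by blast
  qed blast
  let ?le = "\<lambda>a b :: 'm. of_groth b - of_groth a \<in> P"
  have "additive_order ?le"
  proof
    fix a b c :: 'm
    show "?le a b \<or> ?le b a"
      using tot[of "of_groth b - of_groth a"] by simp
    show "a = b" if "?le a b" "?le b a"
    proof -
      have "of_groth b - of_groth a = 0"
        using P that minus_diff_eq[of "of_groth b" "of_groth a"] by (auto simp: positive_cone_def)
      thus ?thesis using inj_of_groth by (auto dest: injD)
    qed
    show "?le a c" if "?le a b" "?le b c"
    proof -
      have "(of_groth b - of_groth a) + (of_groth c - of_groth b) \<in> P"
        using P that unfolding positive_cone_def by blast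
      thus ?thesis by simp
    qed
    show "?le (a + c) (b + c)" if "?le a b"
      using that by (simp add: of_groth_add)
  qed
  thus ?thesis using that by blast
qed

section \<open>Extreme exponents\<close>

text \<open>The relation is a parameter so that the converse of \<open>le\<close> gives the smallest
  exponent.\<close>

definition max_key :: "('m \<Rightarrow> 'm \<Rightarrow> bool) \<Rightarrow> ('m \<Rightarrow>\<^sub>0 's::zero) \<Rightarrow> 'm \<Rightarrow> bool"
  where "max_key le f t \<longleftrightarrow> t \<in> Poly_Mapping.keys f \<and> (\<forall>k\<in>Poly_Mapping.keys f. le k t)"

context additive_order
begin

lemma add_left: "le a b \<Longrightarrow> le (c + a) (c + b)"
  unfolding add.commute[of c] by (rule add_right)

lemma exists_max_key:
  assumes "f \<noteq> 0"
  obtains t where "max_key le f t"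
proof -
  have "\<exists>t\<in>A. \<forall>k\<in>A. le k t" if "finite A" "A \<noteq> {}" for A
    using that
  proof (induction rule: finite_ne_induct)
    case (singleton x)
    show ?case using total[of x x] by simp
  next
    case (insert x A)
    then obtain t where t: "t \<in> A" "\<forall>k\<in>A. le k t" by blast
    show ?case
    proof (cases "le x t")
      case True
      thus ?thesis using t by blast
    next
      case False
      hence "le t x" using total[of x t] by simp
      moreover have "le x x" using total[of x x] by simp
      ultimately have "\<forall>k\<in>insert x A. le k x" using t(2) trans[of _ t x] by blast
      thus ?thesis by blast
    qed
  qed
  moreover have "Poly_Mapping.keys f \<noteq> {}"
    using assms by simp
  ultimately obtain t where "t \<in> Poly_Mapping.keys f" "\<forall>k\<in>Poly_Mapping.keys f. le k t"
    using finite_keys[of f] by meson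
  hence "max_key le f t" by (simp add: max_key_def)
  thus ?thesis by (rule that)
qed

lemma exists_extreme_keys:
  assumes "f \<noteq> 0"
  obtains t b where "max_key le f t" "max_key (\<lambda>a b. le b a) f b"
proof -
  obtain t where "max_key le f t" using assms by (rule exists_max_key)
  moreover obtain b where "max_key (\<lambda>a b. le b a) f b"
    by (rule additive_order.exists_max_key[OF additive_order_converse[OF additive_order_axioms] assms])
  ultimately show ?thesis by (rule that)
qed

text \<open>Only the pair (s, t) contributes to the exponent s + t: if s + t = a + b with a \<le> s
  and b \<le> t, then a + b \<le> s + b \<le> s + t, so equality holds throughout and a = s by
  cancellation.\<close>

lemma lookup_mult_max_key:
  fixes f g :: "'m \<Rightarrow>\<^sub>0 's::comm_semiring_1"
  assumes "max_key le f s" "max_key le g t"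
  shows "Poly_Mapping.lookup (f * g) (s + t) = Poly_Mapping.lookup f s * Poly_Mapping.lookup g t"
proof -
  have uniq: "a = s" if "a \<in> Poly_Mapping.keys f" "b \<in> Poly_Mapping.keys g" "s + t = a + b" for a b
  proof -
    have "le (a + b) (s + b)" "le (s + b) (s + t)"
      using that(1,2) assms by (auto simp: max_key_def intro: add_right add_left)
    hence "a + b = s + b" unfolding that(3) by (rule antisym)
    thus ?thesis by (rule add_right_imp_eq)
  qed
  \<comment> \<open>The term at \<open>l\<close> of the convolution sum in
    \<open>lookup_mult\<close>; at l = s cancellation leaves only q = t.\<close>
  have "Poly_Mapping.lookup f l * (\<Sum>q. Poly_Mapping.lookup g q when s + t = l + q)
      = (Poly_Mapping.lookup f s * Poly_Mapping.lookup g t when l = s)" for l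
  proof (cases "l = s")
    case True
    have "(s + t = s + q) = (q = t)" for q
      by (auto dest: add_left_imp_eq)
    thus ?thesis using True by simp
  next
    case False
    have "(Poly_Mapping.lookup g q when s + t = l + q) = 0" if "l \<in> Poly_Mapping.keys f" for q
      using uniq[OF that, of q] False by (auto simp: when_def in_keys_iff)
    thus ?thesis using False by (cases "l \<in> Poly_Mapping.keys f") (auto simp: in_keys_iff)
  qed
  thus ?thesis by (simp add: lookup_mult)
qed

text \<open>The coefficient at s + t is a product of two nonzero coefficients, so it does not
  vanish.\<close>

lemma max_key_mult:
  fixes f g :: "'m \<Rightarrow>\<^sub>0 's::comm_semiring_1"
  assumes nzd: "\<And>x y :: 's. x * y = 0 \<Longrightarrow> x = 0 \<or> y = 0"
    and fs: "max_key le f s" and gt: "max_key le g t"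
  shows "max_key le (f * g) (s + t)"
  unfolding max_key_def
proof (intro conjI ballI)
  show "s + t \<in> Poly_Mapping.keys (f * g)"
    using lookup_mult_max_key[OF fs gt] nzd fs gt by (auto simp: max_key_def in_keys_iff)
  fix k assume "k \<in> Poly_Mapping.keys (f * g)"
  then obtain a b where "k = a + b" "a \<in> Poly_Mapping.keys f" "b \<in> Poly_Mapping.keys g"
    using keys_mult by blast
  thus "le k (s + t)"
    using fs gt by (auto simp: max_key_def intro: trans[OF add_right add_left])
qed

end

section \<open>Constant polynomial expressions\<close>

lemma constant_poly_iff_keys: "constant_poly f \<longleftrightarrow> Poly_Mapping.keys f \<subseteq> {0}"
proof
  assume "Poly_Mapping.keys f \<subseteq> {0}"
  hence "f = Poly_Mapping.single 0 (Poly_Mapping.lookup f 0)"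
    by (intro poly_mapping_eqI) (auto simp: lookup_single when_def in_keys_iff)
  thus "constant_poly f" unfolding constant_poly_def by blast
qed (auto simp: constant_poly_def split: if_splits)

lemma lookup_single_zero_mult:
  fixes g :: "'m::comm_monoid_add \<Rightarrow>\<^sub>0 's::comm_semiring_1"
  shows "Poly_Mapping.lookup (Poly_Mapping.single 0 d * g) k = d * Poly_Mapping.lookup g k"
  unfolding mult_map_scale_conv_mult[symmetric] by transfer (simp add: when_def)

lemma single_zero_mult:
  fixes a b :: "'s::comm_semiring_1"
  shows "Poly_Mapping.single (0::'m::comm_monoid_add) (a * b)
    = Poly_Mapping.single 0 a * Poly_Mapping.single 0 b"
  by (simp add: mult_single)

section \<open>Atomic elements\<close>

text \<open>With v inverse to u, p = v(up) is irreducible, so its nonunit factor is irreducible; up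
  is a nonunit because p divides it.\<close>

lemma irreducible_unit_mult:
  assumes u: "u dvd 1" and p: "irreducible (p :: 's::comm_semiring_1)"
  shows "irreducible (u * p)"
proof -
  obtain v where uv: "u * v = 1" using u by (auto simp: dvd_def)
  have "v * (u * p) = (u * v) * p" by (simp only: ac_simps)
  hence "irreducible (v * (u * p))" using p uv by simp
  moreover have "\<not> u * p dvd 1"
    using p by (meson dvd_mult_right irreducible_not_unit)
  ultimately show ?thesis
    using irreducible_multD[of v "u * p"] by blast
qed

lemma atomic_elem_unit_mult:
  assumes u: "u dvd 1" and a: "atomic_elem (a :: 's::comm_semiring_1)"
  shows "atomic_elem (u * a)"
  using a unfolding atomic_elem_def
proof (elim disjE exE conjE)
  assume "a dvd 1"
  hence "u * a dvd 1" using u mult_dvd_mono[of u 1 a 1] by simp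
  thus "u * a dvd 1 \<or> (\<exists>A. A \<noteq> {#} \<and> (\<forall>p\<in>#A. irreducible p) \<and> u * a = prod_mset A)" by blast
next
  fix A assume "A \<noteq> {#}" and A: "\<forall>p\<in>#A. irreducible p" "a = prod_mset A"
  then obtain p B where B: "A = add_mset p B" by (meson multiset_cases)
  \<comment> \<open>The unit is absorbed into one of the atoms.\<close>
  let ?A = "add_mset (u * p) B"
  have "\<forall>q\<in>#?A. irreducible q" using A B irreducible_unit_mult[OF u] by simp
  moreover have "u * a = prod_mset ?A" using A B by (simp add: mult.assoc)
  ultimately show "u * a dvd 1 \<or> (\<exists>A. A \<noteq> {#} \<and> (\<forall>p\<in>#A. irreducible p) \<and> u * a = prod_mset A)"
    by (intro disjI2 exI[of _ ?A]) simp
qed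

lemma atomic_elem_mult:
  assumes "atomic_elem (a :: 's::comm_semiring_1)" "atomic_elem b"
  shows "atomic_elem (a * b)"
proof (cases "a dvd 1 \<or> b dvd 1")
  case True
  thus ?thesis using atomic_elem_unit_mult assms by (metis mult.commute)
next
  case False
  then obtain A B where AB: "A \<noteq> {#}" "\<forall>p\<in>#A. irreducible p" "a = prod_mset A"
      "\<forall>p\<in>#B. irreducible p" "b = prod_mset B"
    using assms by (auto simp: atomic_elem_def)
  hence "A + B \<noteq> {#} \<and> (\<forall>p\<in>#A + B. irreducible p) \<and> a * b = prod_mset (A + B)" by auto
  thus ?thesis unfolding atomic_elem_def by blast
qed

lemma atomic_elem_irreducible: "irreducible p \<Longrightarrow> atomic_elem p"
  unfolding atomic_elem_def by (intro disjI2 exI[of _ "{#p#}"]) auto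

lemma atomic_elem_1: "atomic_elem 1"
  by (simp add: atomic_elem_def)

section \<open>Divisibility in the exponent monoid\<close>

definition strict_divisor :: "('m::comm_monoid_add \<times> 'm) set"
  where "strict_divisor = {(a, b). \<exists>c. c \<noteq> 0 \<and> b = a + c}"

text \<open>A descending chain of proper divisors gives ascending principal ideals. Where these
  stabilize, b(N+1) = b(N) + m = b(N+1) + c(N) + m, so c(N) is invertible and hence 0, a
  contradiction.\<close>

lemma wf_strict_divisor:
  assumes red: "reduced_monoid TYPE('m::{comm_monoid_add, cancel_semigroup_add})"
    and accp: "satisfies_ACCP TYPE('m::{comm_monoid_add, cancel_semigroup_add})"
  shows "wf (strict_divisor :: ('m::{comm_monoid_add, cancel_semigroup_add} \<times> 'm) set)"
  unfolding wf_iff_no_infinite_down_chain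
proof
  assume "\<exists>b :: nat \<Rightarrow> 'm. \<forall>n. (b (Suc n), b n) \<in> strict_divisor"
  then obtain b :: "nat \<Rightarrow> 'm" where "\<forall>n. \<exists>c. c \<noteq> 0 \<and> b n = b (Suc n) + c"
    unfolding strict_divisor_def by blast
  then obtain c where c: "\<And>n. c n \<noteq> 0" "\<And>n. b n = b (Suc n) + c n" by metis
  have "principal_ideal (b n) \<subseteq> principal_ideal (b (Suc n))" for n
    unfolding principal_ideal_def by (subst c(2)) (auto simp: add.assoc)
  then obtain N where "\<And>n. n \<ge> N \<Longrightarrow> principal_ideal (b n) = principal_ideal (b N)"
    using accp unfolding satisfies_ACCP_def by blast
  from this[of "Suc N"] have "principal_ideal (b (Suc N)) = principal_ideal (b N)" by simp
  moreover have "b (Suc N) \<in> principal_ideal (b (Suc N))"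
    unfolding principal_ideal_def by (auto intro: exI[of _ 0])
  ultimately obtain m where "b (Suc N) = b N + m"
    unfolding principal_ideal_def by blast
  hence "b (Suc N) + (c N + m) = b (Suc N) + 0"
    using c(2)[of N] by (simp add: add.assoc)
  hence "c N + m = 0" by (rule add_left_imp_eq)
  thus False using red c(1) unfolding reduced_monoid_def by blast
qed

section \<open>Monoid semidomains\<close>

lemma semidomain_no_zero_divisors:
  assumes "semidomain TYPE('s::{comm_semiring_1, cancel_semigroup_add})" "(x::'s::{comm_semiring_1, cancel_semigroup_add}) * y = 0"
  shows "x = 0 \<or> y = 0"
proof -
  have "of_groth x * of_groth y = 0"
    using assms(2) by (simp add: of_groth_mult[symmetric] of_groth_0)
  hence "of_groth x = of_groth 0 \<or> of_groth y = of_groth 0"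
    using assms(1) by (simp add: semidomain_def of_groth_0)
  thus ?thesis using inj_of_groth by (auto dest: injD)
qed

text \<open>The difference x - y is formed in the Grothendieck ring, which has no zero
  divisors.\<close>

lemma semidomain_mult_left_cancel:
  assumes "semidomain TYPE('s::{comm_semiring_1, cancel_semigroup_add})"
    and "(d::'s::{comm_semiring_1, cancel_semigroup_add}) * x = d * y" "d \<noteq> 0"
  shows "x = y"
proof -
  have "of_groth d * (of_groth x - of_groth y) = 0"
    using assms(2) by (simp add: right_diff_distrib of_groth_mult[symmetric])
  moreover have "of_groth d \<noteq> 0"
    using assms(3) inj_of_groth by (metis injD of_groth_0)
  ultimately have "of_groth x = of_groth y"
    using assms(1) unfolding semidomain_def by fastforce
  thus ?thesis using inj_of_groth by (auto dest: injD)
qed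

locale monoid_semidomain = additive_order le
  for le :: "'m::{comm_monoid_add, cancel_semigroup_add} \<Rightarrow> 'm \<Rightarrow> bool" +
  fixes S :: "'s::{comm_semiring_1, cancel_semigroup_add} itself"
  assumes semidomain: "semidomain TYPE('s)"
    and reduced: "reduced_monoid TYPE('m)"
begin

text \<open>All exponents lie between b and t, so t = b = 0 leaves only the exponent 0.\<close>

lemma constant_poly_iff_extremes:
  fixes f :: "'m \<Rightarrow>\<^sub>0 's"
  assumes "max_key le f t" "max_key (\<lambda>a b. le b a) f b"
  shows "constant_poly f \<longleftrightarrow> t = 0 \<and> b = 0"
proof
  assume "t = 0 \<and> b = 0"
  hence "k = 0" if "k \<in> Poly_Mapping.keys f" for k
    using that assms by (auto simp: max_key_def intro: antisym)
  thus "constant_poly f" by (auto simp: constant_poly_iff_keys)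
qed (use assms in \<open>auto simp: constant_poly_iff_keys max_key_def\<close>)

text \<open>The extreme exponents of a nonzero product are sums of those of the factors, and in a
  reduced monoid a sum is 0 only if both summands are.\<close>

lemma constant_poly_multD:
  fixes f g :: "'m \<Rightarrow>\<^sub>0 's"
  assumes "constant_poly (f * g)" "f * g \<noteq> 0"
  shows "constant_poly f" "constant_poly g"
proof -
  note nzd = semidomain_no_zero_divisors[OF semidomain]
  interpret conv: additive_order "\<lambda>a b. le b a"
    by (rule additive_order_converse) (rule additive_order_axioms)
  have "f \<noteq> 0" "g \<noteq> 0" using assms(2) by auto
  then obtain s t s' t' where
    st: "max_key le f s" "max_key le g t"
      "max_key (\<lambda>a b. le b a) f s'" "max_key (\<lambda>a b. le b a) g t'"
    by (elim exists_extreme_keys)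
  have "s + t = 0 \<and> s' + t' = 0"
    using constant_poly_iff_extremes[OF max_key_mult[OF nzd st(1,2)] conv.max_key_mult[OF nzd st(3,4)]]
      assms(1) by simp
  moreover have "x = 0 \<and> y = 0" if "x + y = 0" for x y :: 'm
    using reduced that unfolding reduced_monoid_def by (metis add.commute)
  ultimately have "s = 0 \<and> t = 0 \<and> s' = 0 \<and> t' = 0" by blast
  thus "constant_poly f" "constant_poly g"
    using constant_poly_iff_extremes[OF st(1,3)] constant_poly_iff_extremes[OF st(2,4)] by simp_all
qed

section \<open>Units and atoms of S viewed in S[M]\<close>

lemma single_zero_dvd_1_iff:
  "Poly_Mapping.single (0::'m) (c::'s) dvd 1 \<longleftrightarrow> c dvd 1"
proof
  assume "c dvd 1"
  then obtain e where "1 = c * e" by (auto simp: dvd_def)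
  hence "1 = Poly_Mapping.single (0::'m) c * Poly_Mapping.single 0 e"
    by (metis single_one single_zero_mult)
  thus "Poly_Mapping.single (0::'m) c dvd 1" by (rule dvdI)
next
  assume "Poly_Mapping.single (0::'m) c dvd 1"
  then obtain g where "1 = Poly_Mapping.single (0::'m) c * g" by (auto simp: dvd_def)
  hence "c * Poly_Mapping.lookup g 0 = Poly_Mapping.lookup 1 0"
    using lookup_single_zero_mult[of c g 0] by simp
  thus "c dvd 1" by (metis dvdI lookup_one_zero)
qed

lemma constant_poly_unit:
  fixes f :: "'m \<Rightarrow>\<^sub>0 's"
  assumes "f dvd 1"
  shows "constant_poly f"
proof -
  obtain g where g: "1 = f * g" using assms by (auto simp: dvd_def)
  have "constant_poly (1 :: 'm \<Rightarrow>\<^sub>0 's)" by (simp add: constant_poly_iff_keys)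
  thus ?thesis using constant_poly_multD(1)[of f g] g by simp
qed

text \<open>Factors of a nonzero constant are constant, so every factorization already takes place
  in S.\<close>

lemma irreducible_single_zero:
  assumes "irreducible (c::'s)"
  shows "irreducible (Poly_Mapping.single (0::'m) c)"
proof (rule irreducibleI)
  have c: "c \<noteq> 0" using assms by auto
  thus ne: "Poly_Mapping.single (0::'m) c \<noteq> 0"
    by (metis lookup_single_eq lookup_zero)
  show "\<not> Poly_Mapping.single (0::'m) c dvd 1"
    using assms irreducible_not_unit by (simp add: single_zero_dvd_1_iff)
  fix f g :: "'m \<Rightarrow>\<^sub>0 's" assume fg: "Poly_Mapping.single 0 c = f * g"
  have "constant_poly (f * g)" "f * g \<noteq> 0"
    using fg ne unfolding constant_poly_def by metis+
  then obtain a b where ab: "f = Poly_Mapping.single 0 a" "g = Poly_Mapping.single 0 b"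
    using constant_poly_multD unfolding constant_poly_def by blast
  hence "Poly_Mapping.single (0::'m) c = Poly_Mapping.single 0 (a * b)"
    using fg by (simp add: mult_single)
  hence "c = a * b" by (metis lookup_single_eq)
  thus "f dvd 1 \<or> g dvd 1"
    using assms irreducibleD ab by (auto simp: single_zero_dvd_1_iff)
qed

lemma atomic_elem_single_zero:
  assumes "atomic_elem (c::'s)"
  shows "atomic_elem (Poly_Mapping.single (0::'m) c)"
proof -
  have "atomic_elem (Poly_Mapping.single (0::'m) (prod_mset A))"
    if "\<forall>p\<in>#A. irreducible p" for A :: "'s multiset"
    using that
  proof (induction A)
    case empty
    show ?case by (simp add: atomic_elem_1)
  next
    case (add p A)
    have "atomic_elem (Poly_Mapping.single (0::'m) p)"
      using add by (intro atomic_elem_irreducible irreducible_single_zero) auto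
    thus ?case using add by (simp add: single_zero_mult atomic_elem_mult)
  qed
  moreover have "atomic_elem (Poly_Mapping.single (0::'m) c)" if "c dvd 1"
    using that by (simp add: atomic_elem_def single_zero_dvd_1_iff)
  ultimately show ?thesis using assms unfolding atomic_elem_def[of c] by blast
qed

text \<open>The quotient g = f/d has only units as constant divisors, and any factorization of g has
  a constant factor because f is indecomposable. So g is a unit if constant and an atom
  otherwise.\<close>

lemma indecomposable_eq_constant_mult_atomic:
  fixes f :: "'m \<Rightarrow>\<^sub>0 's"
  assumes ind: "indecomposable f" and mcd: "maximal_common_divisor d (Poly_Mapping.range f)"
  obtains g where "f = Poly_Mapping.single 0 d * g" "atomic_elem g"
proof -
  have d: "d \<noteq> 0" "\<And>c. c \<in> Poly_Mapping.range f \<Longrightarrow> d dvd c"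
    using mcd by (auto simp: maximal_common_divisor_def common_divisor_def)
  \<comment> \<open>\<open>Poly_Mapping.map\<close> applies the choice of a quotient to nonzero
    coefficients only and keeps zeros, so the support stays finite.\<close>
  define g where "g = Poly_Mapping.map (\<lambda>c. SOME u. c = d * u) f"
  have lookup_g: "Poly_Mapping.lookup f k = d * Poly_Mapping.lookup g k" for k
  proof (cases "k \<in> Poly_Mapping.keys f")
    case True
    hence "\<exists>u. Poly_Mapping.lookup f k = d * u"
      using d(2)[of "Poly_Mapping.lookup f k"] by (auto simp: dvd_def)
    from someI_ex[OF this] show ?thesis
      using True by (simp add: g_def map.rep_eq in_keys_iff)
  next
    case False
    thus ?thesis by (simp add: g_def map.rep_eq in_keys_iff)
  qed
  have f: "f = Poly_Mapping.single 0 d * g"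
    by (intro poly_mapping_eqI) (simp add: lookup_single_zero_mult lookup_g)
  have f0: "f \<noteq> 0" using ind by (simp add: indecomposable_def)
  hence g0: "g \<noteq> 0" using f by auto
  \<comment> \<open>By cancellation each \<open>u\<close> with \<open>d * u\<close> a coefficient of
    \<open>f\<close> is a coefficient of \<open>g\<close>, so \<open>e\<close> divides all the
    quotients and maximality of \<open>d\<close> applies.\<close>
  have unit: "e dvd 1" if e: "\<And>k. e dvd Poly_Mapping.lookup g k" for e
  proof -
    have "e \<noteq> 0"
    proof
      assume "e = 0"
      hence "g = 0" using e by (intro poly_mapping_eqI) simp
      thus False using g0 by blast
    qed
    moreover have "e dvd u" if u: "d * u \<in> Poly_Mapping.range f" for u
    proof -
      obtain k where "d * u = Poly_Mapping.lookup f k"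
        using u by transfer auto
      hence "u = Poly_Mapping.lookup g k"
        using semidomain_mult_left_cancel[OF semidomain _ d(1)] lookup_g by metis
      thus ?thesis using e by simp
    qed
    ultimately show ?thesis
      using mcd by (auto simp: maximal_common_divisor_def common_divisor_def)
  qed
  have const_unit: "a dvd 1" if a: "constant_poly a" "a dvd g" for a
  proof -
    obtain e h where "a = Poly_Mapping.single 0 e" "g = Poly_Mapping.single 0 e * h"
      using a by (auto simp: constant_poly_def dvd_def)
    thus ?thesis using unit[of e] by (simp add: single_zero_dvd_1_iff lookup_single_zero_mult)
  qed
  have "atomic_elem g"
  proof (cases "constant_poly g")
    case True
    thus ?thesis using const_unit[of g] by (simp add: atomic_elem_def)
  next
    case False
    have "irreducible g"
    proof (rule irreducibleI)
      show "\<not> g dvd 1" using False constant_poly_unit by blast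
      fix a b assume ab: "g = a * b"
      have "constant_poly a \<or> constant_poly b"
      proof (rule ccontr)
        assume nc: "\<not> (constant_poly a \<or> constant_poly b)"
        \<comment> \<open>Moving \<open>d\<close> into \<open>a\<close> would split \<open>f\<close>
          into two nonconstant factors: if the nonzero product of \<open>d\<close> and
          \<open>a\<close> were constant, so would be \<open>a\<close>.\<close>
        have eq: "f = (Poly_Mapping.single 0 d * a) * b" using f ab by (simp add: mult.assoc)
        hence "Poly_Mapping.single 0 d * a \<noteq> 0" using f0 by auto
        hence "\<not> constant_poly (Poly_Mapping.single 0 d * a)"
          using constant_poly_multD(2) nc by blast
        thus False using ind eq nc unfolding indecomposable_def by blast
      qed
      thus "a dvd 1 \<or> b dvd 1" using const_unit ab by auto
    qed (fact g0)
    thus ?thesis by (rule atomic_elem_irreducible)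
  qed
  with f show ?thesis using that by blast
qed

lemma eq_constant_mult_atomic:
  fixes f :: "'m \<Rightarrow>\<^sub>0 's"
  assumes accp: "satisfies_ACCP TYPE('m)"
    and mcd: "\<And>f :: 'm \<Rightarrow>\<^sub>0 's. indecomposable f \<Longrightarrow>
           \<exists>d. maximal_common_divisor d (Poly_Mapping.range f)"
    and f0: "f \<noteq> 0"
  obtains d g where "f = Poly_Mapping.single 0 d * g" "d \<noteq> 0" "atomic_elem g"
proof -
  note nzd = semidomain_no_zero_divisors[OF semidomain]
  interpret conv: additive_order "\<lambda>a b. le b a"
    by (rule additive_order_converse) (rule additive_order_axioms)
  \<comment> \<open>Both extremes are tracked because a nonconstant expression may have largest
    exponent 0, its other exponents lying below 0 in \<open>le\<close>. Removing a nonconstant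
    factor lowers the first component, or keeps it and lowers the second, hence the lexicographic
    product.\<close>
  have wf: "wf (strict_divisor <*lex*> strict_divisor :: (('m \<times> 'm) \<times> 'm \<times> 'm) set)"
    by (intro wf_lex_prod wf_strict_divisor reduced accp)
  have main: "\<exists>d g. f = Poly_Mapping.single 0 d * g \<and> atomic_elem g"
    if "max_key le f (fst p)" "max_key (\<lambda>a b. le b a) f (snd p)" for f :: "'m \<Rightarrow>\<^sub>0 's" and p
    using wf that
  proof (induction p arbitrary: f rule: wf_induct_rule)
    case (less p)
    note keys_f = less.prems
    have f0: "f \<noteq> 0" using keys_f by (auto simp: max_key_def)
    show ?case
    proof (cases "indecomposable f")
      case True
      then obtain d where "maximal_common_divisor d (Poly_Mapping.range f)" using mcd by blast
      with True show ?thesis using indecomposable_eq_constant_mult_atomic by blast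
    next
      case False
      then obtain g h where gh: "\<not> constant_poly g" "\<not> constant_poly h" "f = g * h"
        using f0 by (auto simp: indecomposable_def)
      have "g \<noteq> 0" "h \<noteq> 0" using gh f0 by auto
      then obtain s s' t t' where
        st: "max_key le g s" "max_key (\<lambda>a b. le b a) g s'"
          "max_key le h t" "max_key (\<lambda>a b. le b a) h t'"
        by (elim exists_extreme_keys)
      \<comment> \<open>Extreme exponents are unique by antisymmetry, so those of \<open>f\<close>
        are the sums.\<close>
      have sum: "fst p = s + t" "snd p = s' + t'"
        using max_key_mult[OF nzd st(1,3)] conv.max_key_mult[OF nzd st(2,4)] keys_f gh(3)
        by (auto simp: max_key_def intro: antisym)
      have nz: "\<not> (s = 0 \<and> s' = 0)" "\<not> (t = 0 \<and> t' = 0)"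
        using constant_poly_iff_extremes[OF st(1,2)] constant_poly_iff_extremes[OF st(3,4)] gh
        by simp_all
      \<comment> \<open>The pair of \<open>g\<close> is smaller because the cofactor
        \<open>h\<close> is nonconstant, and vice versa below.\<close>
      have "((s, s'), p) \<in> strict_divisor <*lex*> strict_divisor"
        using sum nz(2) by (cases p) (auto simp: strict_divisor_def)
      then obtain d1 g1 where g1: "g = Poly_Mapping.single 0 d1 * g1" "atomic_elem g1"
        using less.IH[of "(s, s')" g] st by auto
      have "((t, t'), p) \<in> strict_divisor <*lex*> strict_divisor"
        using sum nz(1) by (cases p) (auto simp: strict_divisor_def add.commute)
      then obtain d2 g2 where g2: "h = Poly_Mapping.single 0 d2 * g2" "atomic_elem g2"
        using less.IH[of "(t, t')" h] st by auto
      have "f = Poly_Mapping.single 0 (d1 * d2) * (g1 * g2)"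
        unfolding gh(3) g1(1) g2(1) single_zero_mult by (simp only: ac_simps)
      thus ?thesis using atomic_elem_mult g1(2) g2(2) by blast
    qed
  qed
  obtain t b where "max_key le f t" "max_key (\<lambda>a b. le b a) f b"
    using f0 by (elim exists_extreme_keys)
  then obtain d g where dg: "f = Poly_Mapping.single 0 d * g" "atomic_elem g"
    using main[of f "(t, b)"] by auto
  moreover have "d \<noteq> 0" using dg f0 by auto
  ultimately show ?thesis using that by blast
qed

end

theorem theorem3p2:
  assumes "torsion_free_monoid TYPE('m::{comm_monoid_add, cancel_semigroup_add})"
    and "reduced_monoid TYPE('m)"
    and "satisfies_ACCP TYPE('m)"
    and "semidomain TYPE('s::{comm_semiring_1, cancel_semigroup_add})"
    and "\<And>f :: 'm \<Rightarrow>\<^sub>0 's. indecomposable f \<Longrightarrow>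
           \<exists>d. maximal_common_divisor d (Poly_Mapping.range f)"
  shows "(almost_atomic TYPE('s) \<longrightarrow> almost_atomic TYPE('m \<Rightarrow>\<^sub>0 's)) \<and>
         (quasi_atomic TYPE('s) \<longrightarrow> quasi_atomic TYPE('m \<Rightarrow>\<^sub>0 's))"
proof -
  obtain le :: "'m \<Rightarrow> 'm \<Rightarrow> bool" where "additive_order le"
    using torsion_free_imp_additive_order assms(1) by blast
  then interpret monoid_semidomain le "TYPE('s)"
    using assms(2,4) by (intro monoid_semidomain.intro monoid_semidomain_axioms.intro)
  \<comment> \<open>The common core of both claims. The constant \<open>d\<close> depends on
    \<open>f\<close> alone, so the hypothesis on S can be applied to \<open>d\<close>; a multiplier
    \<open>a\<close> with \<open>a * d\<close> atomic then makes a f = (a d) g a product of atomic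
    elements.\<close>
  have lift: "\<exists>d::'s. d \<noteq> 0 \<and> (\<forall>a. a \<noteq> 0 \<longrightarrow> atomic_elem (a * d) \<longrightarrow>
      Poly_Mapping.single 0 a \<noteq> (0 :: 'm \<Rightarrow>\<^sub>0 's) \<and> atomic_elem (Poly_Mapping.single 0 a * f))"
    if "f \<noteq> 0" for f :: "'m \<Rightarrow>\<^sub>0 's"
  proof -
    obtain d g where dg: "f = Poly_Mapping.single 0 d * g" "d \<noteq> 0" "atomic_elem g"
      using eq_constant_mult_atomic[OF assms(3,5) \<open>f \<noteq> 0\<close>] by blast
    have "Poly_Mapping.single 0 a \<noteq> (0 :: 'm \<Rightarrow>\<^sub>0 's)" if "a \<noteq> 0" for a :: 's
      using that by (metis lookup_single_eq lookup_zero)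
    moreover have "atomic_elem (Poly_Mapping.single 0 a * f)" if "atomic_elem (a * d)" for a
    proof -
      have "Poly_Mapping.single 0 a * f = Poly_Mapping.single 0 (a * d) * g"
        by (simp add: dg(1) single_zero_mult mult.assoc)
      thus ?thesis using atomic_elem_mult[OF atomic_elem_single_zero[OF that] dg(3)] by simp
    qed
    ultimately show ?thesis using dg(2) by blast
  qed
  have "almost_atomic TYPE('m \<Rightarrow>\<^sub>0 's)" if S: "almost_atomic TYPE('s)"
    unfolding almost_atomic_def
  proof (intro allI impI)
    fix f :: "'m \<Rightarrow>\<^sub>0 's" assume "f \<noteq> 0"
    \<comment> \<open>The multiplier from S, taken as a constant, remains atomic in S[M].\<close>
    from lift[OF this] S show "\<exists>a. a \<noteq> 0 \<and> atomic_elem a \<and> atomic_elem (a * f)"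
      unfolding almost_atomic_def by (metis atomic_elem_single_zero)
  qed
  moreover have "quasi_atomic TYPE('m \<Rightarrow>\<^sub>0 's)" if S: "quasi_atomic TYPE('s)"
    unfolding quasi_atomic_def
  proof (intro allI impI)
    fix f :: "'m \<Rightarrow>\<^sub>0 's" assume "f \<noteq> 0"
    from lift[OF this] S show "\<exists>a. a \<noteq> 0 \<and> atomic_elem (a * f)"
      unfolding quasi_atomic_def by metis
  qed
  ultimately show ?thesis by blast
qed

end
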